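(* Let $L\in\mathbb{R}^{n\times n}$ be irreducible with zero column sums, spectral abscissa $0$ with $0$ a simple eigenvalue, and eventually exponentially positive, and let $\boldsymbol p^\infty$ be its stationary density and $\Pi$ its spectral projector for the eigenvalue $0$. Let $r(z)=(1+z/2)/(1-z/2)$, so that $r(\gamma L)=(\mathcal I-\tfrac{\gamma}{2}L)^{-1}(\mathcal I+\tfrac{\gamma}{2}L)=-\mathcal I+2(\mathcal I-\tfrac{\gamma}{2}L)^{-1}$ for $\gamma>0$. Then: (a) $r(\gamma L)\to-\mathcal I+2\Pi$ entrywise as $\gamma\to\infty$; hence, if $p^\infty_i<1/2$ for some node (index) $i$, there exists $\gamma_+<\infty$ such that $r(\gamma L)$ has a negative diagonal entry for all $\gamma>\gamma_+$. (b) If $L$ has a negative off-diagonal entry, there exists $\gamma_->0$ such that $r(\gamma L)$ has a negative entry for all $\gamma\in(0,\gamma_-)$. (c) Nonnegativity of $r(\gamma L)$ can therefore hold at most on a bounded window $\gamma\in[\gamma_-,\gamma_+]$. The window is nonempty whenever the resolvent window at shift $\gamma/2$, that is the set $\{\gamma>0:(\mathcal I-\tfrac{\gamma}{2}L)^{-1}>0\}$, intersects the set $\{\gamma:\operatorname{diag}(\mathcal I-\tfrac{\gamma}{2}L)^{-1}\ge\tfrac12\}$.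
   Context: $\mathcal I$ is the identity matrix. Matrix inequalities $>0$, $\ge0$ are entrywise, and $\operatorname{diag}(M)\ge\tfrac12$ means that every diagonal entry of $M$ is at least $\tfrac12$. $L$ is eventually exponentially positive if there is $\tau_0\ge0$ such that $e^{tL}>0$ for all $t\ge\tau_0$. The spectral abscissa is the maximal real part of the eigenvalues. The stationary density $\boldsymbol p^\infty$ is the right null vector of $L$ normalized by $\sum_i p^\infty_i=1$ (it is entrywise positive), and $\Pi=\lim_{t\to\infty}e^{tL}$ is the spectral projector onto $\ker L$ along $\operatorname{ran}L$, with entries $\Pi_{ij}=p^\infty_i$. The numbers $\gamma_-,\gamma_+$ in (c) are those of (b) and (a). *)

theory Defs
  imports "HOL-Analysis.Analysis" "HOL-Computational_Algebra.Polynomial"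
begin

text \<open>Products, powers and exponentials are those of matrix multiplication \<open>**\<close>; the
  componentwise \<open>*\<close> and the type-class \<open>exp\<close> are not used.\<close>

definition mat_power :: "real^'n^'n \<Rightarrow> nat \<Rightarrow> real^'n^'n" where
  "mat_power A k = ((\<lambda>B. A ** B) ^^ k) (mat 1)"

definition mat_exp :: "real^'n^'n \<Rightarrow> real^'n^'n" where
  "mat_exp A = (\<Sum>k. (1 / fact k) *\<^sub>R mat_power A k)"

definition mat_positive :: "real^'n^'n \<Rightarrow> bool" where
  "mat_positive A \<longleftrightarrow> (\<forall>i j. 0 < A $ i $ j)"

definition mat_nonneg :: "real^'n^'n \<Rightarrow> bool" where
  "mat_nonneg A \<longleftrightarrow> (\<forall>i j. 0 \<le> A $ i $ j)"

text \<open>No simultaneous permutation of rows and columns makes \<open>A\<close> block triangular with two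
  nonempty diagonal blocks. Entries of either sign count, and every 1 by 1 matrix is irreducible.\<close>

definition mat_irreducible :: "real^'n^'n \<Rightarrow> bool" where
  "mat_irreducible A \<longleftrightarrow>
     \<not> (\<exists>S. S \<noteq> {} \<and> S \<noteq> UNIV \<and> (\<forall>i\<in>S. \<forall>j\<in>-S. A $ i $ j = 0))"

definition zero_column_sums :: "real^'n^'n \<Rightarrow> bool" where
  "zero_column_sums A \<longleftrightarrow> (\<forall>j. (\<Sum>i\<in>UNIV. A $ i $ j) = 0)"

definition complex_mat :: "real^'n^'n \<Rightarrow> complex^'n^'n" where
  "complex_mat A = map_matrix complex_of_real A"

definition eigenvalues :: "real^'n^'n \<Rightarrow> complex set" where
  "eigenvalues A = {z. \<exists>v. v \<noteq> 0 \<and> complex_mat A *v v = z *s v}"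

definition spectral_abscissa :: "real^'n^'n \<Rightarrow> real" where
  "spectral_abscissa A = Max (Re ` eigenvalues A)"

definition char_polynomial :: "real^'n^'n \<Rightarrow> complex poly" where
  "char_polynomial A =
     det (\<chi> i j. (if i = j then [:0, 1:] else 0) - [:complex_mat A $ i $ j:])"

definition simple_eigenvalue :: "real^'n^'n \<Rightarrow> complex \<Rightarrow> bool" where
  "simple_eigenvalue A z \<longleftrightarrow> z \<in> eigenvalues A \<and> order z (char_polynomial A) = 1"

definition eventually_exp_positive :: "real^'n^'n \<Rightarrow> bool" where
  "eventually_exp_positive A \<longleftrightarrow>
     (\<exists>\<tau>\<ge>0. \<forall>t\<ge>\<tau>. mat_positive (mat_exp (t *\<^sub>R A)))"

text \<open>The two descriptions below determine a unique object as soon as 0 is a simple eigenvalue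
  (for the first: and the column sums vanish).\<close>

definition stationary_density :: "real^'n^'n \<Rightarrow> real^'n" where
  "stationary_density A = (THE p. A *v p = 0 \<and> (\<Sum>i\<in>UNIV. p $ i) = 1)"

definition zero_projector :: "real^'n^'n \<Rightarrow> real^'n^'n" where
  "zero_projector A =
     (THE P. P ** P = P \<and> range ((*v) P) = {x. A *v x = 0} \<and> {x. P *v x = 0} = range ((*v) A))"

definition resolvent :: "real^'n^'n \<Rightarrow> real \<Rightarrow> real^'n^'n" where
  "resolvent A s = matrix_inv (mat 1 - s *\<^sub>R A)"

text \<open>\<open>r(z) = (1 + z/2) / (1 - z/2)\<close> evaluated at the matrix \<open>A\<close>.\<close>

definition cayley :: "real^'n^'n \<Rightarrow> real^'n^'n" where
  "cayley A = matrix_inv (mat 1 - (1/2) *\<^sub>R A) ** (mat 1 + (1/2) *\<^sub>R A)"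

text \<open>The properties required of \<open>\<gamma>\<^sub>+\<close> and \<open>\<gamma>\<^sub>-\<close>, respectively.\<close>

definition upper_threshold :: "real^'n^'n \<Rightarrow> real \<Rightarrow> bool" where
  "upper_threshold A g \<longleftrightarrow> 0 < g \<and> (\<forall>\<gamma>>g. \<exists>i. cayley (\<gamma> *\<^sub>R A) $ i $ i < 0)"

definition lower_threshold :: "real^'n^'n \<Rightarrow> real \<Rightarrow> bool" where
  "lower_threshold A g \<longleftrightarrow>
     0 < g \<and> (\<forall>\<gamma>\<in>{0<..<g}. \<exists>i j. cayley (\<gamma> *\<^sub>R A) $ i $ j < 0)"

definition nonneg_window :: "real^'n^'n \<Rightarrow> real set" where
  "nonneg_window A = {\<gamma>. 0 < \<gamma> \<and> mat_nonneg (cayley (\<gamma> *\<^sub>R A))}"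

definition resolvent_window :: "real^'n^'n \<Rightarrow> real set" where
  "resolvent_window A = {\<gamma>. 0 < \<gamma> \<and> mat_positive (resolvent A (\<gamma> / 2))}"

end

theory Submission
  imports Defs "HOL-Real_Asymp.Real_Asymp"
begin

text \<open>The sum over the coordinates is a left null vector of \<open>L\<close>. As \<open>M = exp (tL)\<close> is entrywise
  positive for some \<open>t\<close> and has unit column sums, it contracts the \<open>\<ell>\<^sup>1\<close> norm strictly on the
  hyperplane \<open>H\<close> of vectors with zero sum; since \<open>M\<close> fixes \<open>ker L\<close>, the kernel meets \<open>H\<close> trivially.
  By dimension \<open>ran L = H\<close> and \<open>ker L\<close> is a line, so \<open>\<Pi>\<close> has all its columns equal to \<open>p\<^sup>\<infinity>\<close>.
  On \<open>H\<close> the map \<open>L\<close> is bounded below, so \<open>(I - sL)\<^sup>-\<^sup>1\<close> tends to 0 there as \<open>s \<rightarrow> \<infinity>\<close> while fixing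
  \<open>p\<^sup>\<infinity>\<close>; this gives (a). For small \<open>s\<close> the expansion \<open>(I - sL)\<^sup>-\<^sup>1 = I + sL + O(s\<^sup>2)\<close> gives (b).\<close>

section \<open>Spectrum and resolvent\<close>

lemma poly_det: "poly (det M) z = det (\<chi> i j. poly (M $ i $ j) z)"
  by (simp add: det_def poly_sum poly_prod of_int_poly)

text \<open>An eigenvector for z is a nonzero kernel vector of zI - A, and evaluating polynomials at
  z commutes with the determinant. This reduces finiteness of the spectrum to finiteness of the
  roots of a nonzero polynomial.\<close>

lemma eigenvalues_iff_char_polynomial_root:
  "z \<in> eigenvalues A \<longleftrightarrow> poly (char_polynomial A) z = 0"
proof -
  let ?M = "mat z - complex_mat A"
  have zv: "mat z *v v = z *s v" for v :: "complex^'a"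
    by (simp add: vec_eq_iff matrix_vector_mult_def mat_def if_distrib if_distribR
        sum.delta cong: if_cong)
  have "z \<in> eigenvalues A \<longleftrightarrow> (\<exists>v. v \<noteq> 0 \<and> ?M *v v = 0)"
    by (auto simp: eigenvalues_def matrix_vector_mult_diff_rdistrib zv)
  also have "\<dots> \<longleftrightarrow> \<not> invertible ?M"
    unfolding invertible_left_inverse matrix_left_invertible_ker by blast
  also have "\<dots> \<longleftrightarrow> det ?M = 0"
    by (simp add: invertible_det_nz)
  also have "det ?M = poly (char_polynomial A) z"
    unfolding char_polynomial_def poly_det
    by (rule arg_cong[of _ _ det]) (simp add: vec_eq_iff mat_def)
  finally show ?thesis .
qed

text \<open>No number beyond a bound B for the operator norm is an eigenvalue, so B + 1 is a point
  where the polynomial does not vanish. This avoids computing its degree or leading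
  coefficient.\<close>

lemma char_polynomial_nonzero: "char_polynomial A \<noteq> 0"
proof -
  have "linear ((*v) (complex_mat A))" by simp
  then obtain B where B: "B > 0" "\<And>x. norm (complex_mat A *v x) \<le> B * norm x"
    using linear_bounded_pos by blast
  let ?z = "complex_of_real (B + 1)"
  have "?z \<notin> eigenvalues A"
  proof
    assume "?z \<in> eigenvalues A"
    then obtain v where v: "v \<noteq> 0" "complex_mat A *v v = ?z *s v"
      by (auto simp: eigenvalues_def)
    have "?z *s v = (B + 1) *\<^sub>R v"
      by (simp add: vec_eq_iff scaleR_conv_of_real[symmetric] flip: of_real_add)
    then have "norm (complex_mat A *v v) = (B + 1) * norm v"
      using B(1) v(2) by simp
    then show False
      using B(2)[of v] v(1) by (simp add: algebra_simps)
  qed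
  then show ?thesis
    unfolding eigenvalues_iff_char_polynomial_root by auto
qed

lemma finite_eigenvalues: "finite (eigenvalues A)"
  by (rule finite_subset[OF _ poly_roots_finite[OF char_polynomial_nonzero[of A]]])
    (auto simp: eigenvalues_iff_char_polynomial_root)

lemma real_eigenvalue:
  fixes A :: "real^'n^'n"
  assumes "v \<noteq> 0" "A *v v = c *\<^sub>R v"
  shows "complex_of_real c \<in> eigenvalues A"
proof -
  let ?v = "\<chi> i. complex_of_real (v $ i)"
  have "?v \<noteq> 0"
    using assms(1) by (simp add: vec_eq_iff)
  moreover have "(complex_mat A *v ?v) $ i = (complex_of_real c *s ?v) $ i" for i
    using arg_cong[OF assms(2), of "\<lambda>x. complex_of_real (x $ i)"]
    by (simp add: complex_mat_def map_matrix_def matrix_vector_mult_def)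
  ultimately show ?thesis
    unfolding eigenvalues_def vec_eq_iff[of "complex_mat A *v _"] by blast
qed

text \<open>A nonzero kernel vector of I - sA would be an eigenvector of A for the positive
  eigenvalue 1/s, which exceeds the spectral abscissa.\<close>

lemma invertible_resolvent:
  fixes A :: "real^'n^'n"
  assumes "eigenvalues A \<noteq> {}" "spectral_abscissa A \<le> 0" "0 < s"
  shows "invertible (mat 1 - s *\<^sub>R A)"
proof -
  have "v = 0" if "(mat 1 - s *\<^sub>R A) *v v = 0" for v
  proof (rule ccontr)
    assume v: "v \<noteq> 0"
    have "v = s *\<^sub>R (A *v v)"
      using that by (simp add: matrix_vector_mult_diff_rdistrib scaleR_matrix_vector_assoc)
    then have "(1 / s) *\<^sub>R v = (1 / s) *\<^sub>R (s *\<^sub>R (A *v v))" by simp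
    then have "A *v v = (1 / s) *\<^sub>R v"
      using assms(3) by simp
    then have "complex_of_real (1 / s) \<in> eigenvalues A"
      by (rule real_eigenvalue[OF v])
    then have "Re (complex_of_real (1 / s)) \<in> Re ` eigenvalues A"
      by (rule imageI)
    \<comment> \<open>Finiteness of the spectrum makes \<open>Max\<close> an upper bound for the
      real parts.\<close>
    then have "1 / s \<le> spectral_abscissa A"
      unfolding spectral_abscissa_def using finite_eigenvalues[of A] by (intro Max_ge) auto
    then show False
      using assms(2,3) by (smt (verit) zero_less_divide_1_iff)
  qed
  then show ?thesis
    unfolding invertible_left_inverse matrix_left_invertible_ker by blast
qed

lemma matrix_inv_mult:
  fixes M :: "'a::field^'n^'n"
  assumes "invertible M"
  shows "matrix_inv M ** M = mat 1" "M ** matrix_inv M = mat 1"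
  using someI_ex[OF assms[unfolded invertible_def]] by (auto simp: matrix_inv_def)

text \<open>With s = \<gamma>/2 and R the resolvent at s, adding R(I - sA) = I to R(I + sA) gives
  2R.\<close>

lemma cayley_eq_resolvent:
  fixes A :: "real^'n^'n"
  assumes "invertible (mat 1 - (\<gamma> / 2) *\<^sub>R A)"
  shows "cayley (\<gamma> *\<^sub>R A) = resolvent A (\<gamma> / 2) ** (mat 1 + (\<gamma> / 2) *\<^sub>R A)"
    and "cayley (\<gamma> *\<^sub>R A) = - mat 1 + 2 *\<^sub>R resolvent A (\<gamma> / 2)"
proof -
  let ?R = "resolvent A (\<gamma> / 2)"
  show 1: "cayley (\<gamma> *\<^sub>R A) = ?R ** (mat 1 + (\<gamma> / 2) *\<^sub>R A)"
    by (simp add: cayley_def resolvent_def)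
  have "?R ** (mat 1 - (\<gamma> / 2) *\<^sub>R A) = mat 1"
    unfolding resolvent_def by (rule matrix_inv_mult[OF assms])
  then have "cayley (\<gamma> *\<^sub>R A) + mat 1
      = ?R ** ((mat 1 + (\<gamma> / 2) *\<^sub>R A) + (mat 1 - (\<gamma> / 2) *\<^sub>R A))"
    unfolding 1 by (simp only: matrix_add_ldistrib)
  also have "(mat 1 + (\<gamma> / 2) *\<^sub>R A) + (mat 1 - (\<gamma> / 2) *\<^sub>R A) = 2 *\<^sub>R mat 1"
    by (simp add: vec_eq_iff)
  also have "?R ** (2 *\<^sub>R mat 1) = 2 *\<^sub>R ?R"
    by (simp add: matrix_scalar_ac)
  finally show "cayley (\<gamma> *\<^sub>R A) = - mat 1 + 2 *\<^sub>R ?R"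
    by (simp add: eq_diff_eq)
qed

section \<open>The matrix exponential and the kernel of \<open>L\<close>\<close>

lemma mat_power_Suc: "mat_power A (Suc k) = A ** mat_power A k"
  by (simp add: mat_power_def)

text \<open>If B bounds the operator norm of A, then B^k bounds that of the k-th power, hence also
  each of its entries, which are coordinates of images of unit vectors. The scalar exponential
  series of B then dominates every entry.\<close>

lemma summable_mat_exp:
  fixes A :: "real^'n^'n"
  shows "summable (\<lambda>k. (1 / fact k) *\<^sub>R mat_power A k)"
proof -
  obtain B where B: "B > 0" "\<And>x. norm (A *v x) \<le> B * norm x"
    using linear_bounded_pos[of "(*v) A"] by auto
  have power: "norm (mat_power A k *v x) \<le> B ^ k * norm x" for k x
  proof (induction k)
    case (Suc k)
    have "norm (mat_power A (Suc k) *v x) \<le> B * norm (mat_power A k *v x)"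
      using B(2) by (simp add: mat_power_Suc flip: matrix_vector_mul_assoc)
    also have "\<dots> \<le> B * (B ^ k * norm x)"
      using Suc B(1) by simp
    finally show ?case by (simp add: mult.assoc)
  qed (simp add: mat_power_def)
  have entry: "\<bar>mat_power A k $ i $ j\<bar> \<le> B ^ k" for k i j
    using component_le_norm_cart[of "mat_power A k *v axis j 1" i] power[of k "axis j 1"]
    by (simp add: matrix_vector_mult_basis column_def norm_axis_1)
  have "summable (\<lambda>k. (1 / fact k) * mat_power A k $ i $ j)" for i j
  proof (rule summable_comparison_test'[where N = 0])
    show "summable (\<lambda>k. inverse (fact k) * B ^ k)"
      by (rule summable_exp)
    show "norm ((1 / fact k) * mat_power A k $ i $ j) \<le> inverse (fact k) * B ^ k" for k
      using entry by (simp add: abs_mult divide_simps)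
  qed
  then have "(\<lambda>n. \<Sum>k<n. (1 / fact k) * mat_power A k $ i $ j)
      \<longlonglongrightarrow> (\<Sum>k. (1 / fact k) * mat_power A k $ i $ j)" for i j
    by (rule summable_LIMSEQ)
  then have "(\<lambda>k. (1 / fact k) *\<^sub>R mat_power A k)
      sums (\<chi> i j. \<Sum>k. (1 / fact k) * mat_power A k $ i $ j)"
    unfolding sums_def by (intro vec_tendstoI) (simp add: sum_component)
  then show ?thesis by (rule sums_summable)
qed

text \<open>In finite dimension a linear map passes through the series, of which only the term k = 0
  survives. It serves twice: for evaluation at a kernel vector, and for a column sum.\<close>

lemma linear_mat_exp:
  fixes A :: "real^'n^'n" and f :: "real^'n^'n \<Rightarrow> 'b::real_normed_vector"
  assumes "linear f" "\<And>k. f (mat_power A (Suc k)) = 0"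
  shows "f (mat_exp A) = f (mat 1)"
proof -
  have f: "bounded_linear f"
    using assms(1) by (rule linear_conv_bounded_linear[THEN iffD1])
  have "f ((1 / fact k) *\<^sub>R mat_power A k) = (if k = 0 then f (mat 1) else 0)" for k
    using assms by (cases k) (auto simp: mat_power_def linear_scale)
  then have "f (mat_exp A) = (\<Sum>k. if k = 0 then f (mat 1) else 0)"
    unfolding mat_exp_def bounded_linear.suminf[OF f summable_mat_exp] by presburger
  also have "\<dots> = f (mat 1)"
    using sums_single[of 0 "\<lambda>_. f (mat 1)"] by (simp add: sums_iff)
  finally show ?thesis .
qed

lemma mat_exp_fixes_kernel:
  fixes A :: "real^'n^'n"
  assumes "A *v v = 0"
  shows "mat_exp A *v v = v"
proof -
  have "mat_power A (Suc k) *v v = 0" for k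
    using assms by (induction k) (simp_all add: mat_power_def flip: matrix_vector_mul_assoc)
  moreover have "linear (\<lambda>B::real^'n^'n. B *v v)"
    by (rule linearI) (simp_all add: matrix_vector_mult_add_rdistrib scaleR_matrix_vector_assoc)
  ultimately show ?thesis
    using linear_mat_exp[of "\<lambda>B. B *v v" A] by simp
qed

section \<open>Strict contraction of vectors with zero sum\<close>

definition coord_sum :: "real^'n \<Rightarrow> real" where
  "coord_sum x = (\<Sum>i\<in>UNIV. x $ i)"

lemma linear_coord_sum: "linear coord_sum"
  by (rule linearI) (simp_all add: coord_sum_def sum.distrib sum_distrib_left)

lemmas coord_sum_simps =
  linear_add[OF linear_coord_sum] linear_diff[OF linear_coord_sum]
  linear_scale[OF linear_coord_sum]

lemma coord_sum_mult:
  fixes A :: "real^'n^'n"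
  shows "coord_sum (A *v x) = (\<Sum>j\<in>UNIV. (\<Sum>i\<in>UNIV. A $ i $ j) * x $ j)"
  unfolding coord_sum_def matrix_vector_mult_def
  by (simp add: sum_distrib_right) (rule sum.swap)

text \<open>Subtracting the smallest entry \<delta> from all entries of M does not change its action
  on vectors of zero sum and keeps the entries nonnegative, but lowers every column sum to 1 -
  n\<delta> < 1. A fixed vector would thus have an \<ell>1 norm at most 1 - n\<delta> times
  itself.\<close>

lemma positive_stochastic_fixed_point:
  fixes M :: "real^'n^'n"
  assumes pos: "mat_positive M" and cols: "\<And>j. (\<Sum>i\<in>UNIV. M $ i $ j) = 1"
    and fixed: "M *v v = v" and sum0: "coord_sum v = 0"
  shows "v = 0"
proof -
  let ?\<delta> = "Min (range (\<lambda>(i, j). M $ i $ j))"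
  have \<delta>: "0 < ?\<delta>" "\<And>i j. ?\<delta> \<le> M $ i $ j"
    using pos by (auto simp: mat_positive_def intro!: Min_le)
  have "\<bar>v $ i\<bar> \<le> (\<Sum>j\<in>UNIV. (M $ i $ j - ?\<delta>) * \<bar>v $ j\<bar>)" for i
  proof -
    have "v $ i = (\<Sum>j\<in>UNIV. M $ i $ j * v $ j)"
      using arg_cong[OF fixed, of "\<lambda>x. x $ i"] by (simp add: matrix_vector_mult_def)
    also have "\<dots> = (\<Sum>j\<in>UNIV. (M $ i $ j - ?\<delta>) * v $ j)"
      using sum0 by (simp add: left_diff_distrib sum_subtractf coord_sum_def flip: sum_distrib_left)
    finally have "\<bar>v $ i\<bar> \<le> (\<Sum>j\<in>UNIV. \<bar>(M $ i $ j - ?\<delta>) * v $ j\<bar>)"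
      by (metis sum_abs)
    then show ?thesis
      using \<delta>(2) by (simp add: abs_mult)
  qed
  then have "(\<Sum>i\<in>UNIV. \<bar>v $ i\<bar>) \<le> (\<Sum>i\<in>UNIV. \<Sum>j\<in>UNIV. (M $ i $ j - ?\<delta>) * \<bar>v $ j\<bar>)"
    by (rule sum_mono)
  also have "\<dots> = (\<Sum>j\<in>UNIV. (\<Sum>i\<in>UNIV. M $ i $ j - ?\<delta>) * \<bar>v $ j\<bar>)"
    by (subst sum.swap) (simp add: sum_distrib_right)
  also have "\<dots> = (1 - CARD('n) * ?\<delta>) * (\<Sum>i\<in>UNIV. \<bar>v $ i\<bar>)"
    by (simp add: sum_subtractf cols sum_distrib_left)
  finally have "CARD('n) * ?\<delta> * (\<Sum>i\<in>UNIV. \<bar>v $ i\<bar>) \<le> 0"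
    by (simp add: left_diff_distrib)
  then have "(\<Sum>i\<in>UNIV. \<bar>v $ i\<bar>) \<le> 0"
    using \<delta>(1) by (simp add: mult_le_0_iff)
  then have "(\<Sum>i\<in>UNIV. \<bar>v $ i\<bar>) = 0"
    by (intro antisym sum_nonneg) auto
  then show ?thesis
    by (simp add: sum_nonneg_eq_0_iff vec_eq_iff)
qed

section \<open>Kernel, range and spectral projector of \<open>L\<close>, and the limit of its
  resolvent\<close>

locale exp_positive_generator =
  fixes L :: "real^'n^'n"
  assumes zero_cols: "zero_column_sums L"
    and exp_positive: "eventually_exp_positive L"
begin

lemma coord_sum_L: "coord_sum (L *v x) = 0"
  using zero_cols by (simp add: coord_sum_mult zero_column_sums_def)

lemma kernel_zero_sum:
  assumes "L *v v = 0" "coord_sum v = 0"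
  shows "v = 0"
proof -
  obtain t where t: "mat_positive (mat_exp (t *\<^sub>R L))"
    using exp_positive by (auto simp: eventually_exp_positive_def)
  have "(\<Sum>i\<in>UNIV. mat_exp (t *\<^sub>R L) $ i $ j) = 1" for j
  proof -
    \<comment> \<open>The j-th column sum is written through the action on a basis vector, so that
      the leftmost factor \<open>L\<close> of each positive power makes it vanish.\<close>
    let ?f = "\<lambda>B::real^'n^'n. coord_sum (B *v axis j 1)"
    have col: "?f B = (\<Sum>i\<in>UNIV. B $ i $ j)" for B
      by (simp add: coord_sum_def matrix_vector_mult_basis column_def)
    have "?f (mat_exp (t *\<^sub>R L)) = ?f (mat 1)"
    proof (rule linear_mat_exp)
      show "linear ?f"
        unfolding col by (rule linearI) (simp_all add: sum.distrib sum_distrib_left)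
      show "?f (mat_power (t *\<^sub>R L) (Suc k)) = 0" for k
        using coord_sum_L
        by (simp add: mat_power_Suc coord_sum_simps flip: matrix_vector_mul_assoc scaleR_matrix_vector_assoc)
    qed
    also have "\<dots> = 1"
      by (simp add: coord_sum_def axis_def)
    finally show ?thesis by (simp only: col)
  qed
  moreover have "mat_exp (t *\<^sub>R L) *v v = v"
    using assms(1) by (intro mat_exp_fixes_kernel) (simp flip: scaleR_matrix_vector_assoc)
  ultimately show ?thesis
    using positive_stochastic_fixed_point t assms(2) by blast
qed

text \<open>\<open>L\<close> maps the zero-sum hyperplane into itself and is injective there, so by
  dimension it already maps that hyperplane onto itself. Everything else is mapped into it as
  well.\<close>

lemma range_L: "range ((*v) L) = {x. coord_sum x = 0}"
proof -
  let ?H = "{x::real^'n. coord_sum x = 0}"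
  have H: "subspace ?H"
    by (rule linear_subspace_kernel[OF linear_coord_sum])
  have "inj_on ((*v) L) (span ?H)"
    unfolding span_eq_iff[THEN iffD2, OF H]
  proof (rule inj_onI)
    fix x y assume "x \<in> ?H" "y \<in> ?H" "L *v x = L *v y"
    then show "x = y"
      using kernel_zero_sum[of "x - y"]
      by (simp add: coord_sum_simps matrix_vector_mult_diff_distrib)
  qed
  then have "dim ((*v) L ` ?H) = dim ?H"
    by (intro dim_image_eq) auto
  moreover have "subspace ((*v) L ` ?H)"
    by (rule linear_subspace_image[OF _ H]) simp
  moreover have "(*v) L ` ?H \<subseteq> ?H"
    using coord_sum_L by auto
  ultimately have "(*v) L ` ?H = ?H"
    using H by (intro subspace_dim_equal) auto
  then show ?thesis
    using coord_sum_L by blast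
qed

text \<open>A basis vector has sum 1 and so lies outside the range; hence \<open>L\<close> is not
  surjective, and therefore not injective. A nonzero kernel vector cannot have zero sum and can be
  rescaled.\<close>

lemma ex_stationary: "\<exists>p. L *v p = 0 \<and> coord_sum p = 1"
proof -
  have "coord_sum (axis undefined 1 :: real^'n) = 1"
    by (simp add: coord_sum_def axis_def)
  then have "axis undefined 1 \<notin> range ((*v) L)"
    by (simp add: range_L)
  then have "\<not> surj ((*v) L)" by (metis UNIV_I)
  then have "\<not> inj ((*v) L)"
    using linear_injective_imp_surjective[of "(*v) L"] by auto
  then obtain v where v: "L *v v = 0" "v \<noteq> 0"
    using linear_injective_0[of "(*v) L"] by auto
  then have "coord_sum v \<noteq> 0"
    using kernel_zero_sum by blast
  then have "coord_sum ((1 / coord_sum v) *\<^sub>R v) = 1"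
    by (simp add: coord_sum_simps)
  moreover have "L *v ((1 / coord_sum v) *\<^sub>R v) = 0"
    using v(1) by (simp add: matrix_vector_mult_scaleR)
  ultimately show ?thesis by blast
qed

lemma stationary_unique:
  assumes "L *v p = 0" "coord_sum p = 1" "L *v x = 0"
  shows "x = coord_sum x *\<^sub>R p"
  using kernel_zero_sum[of "x - coord_sum x *\<^sub>R p"] assms
  by (simp add: coord_sum_simps matrix_vector_mult_diff_distrib matrix_vector_mult_scaleR)

lemma stationary_density:
  shows "L *v stationary_density L = 0" and "coord_sum (stationary_density L) = 1"
proof -
  obtain p where p: "L *v p = 0" "coord_sum p = 1"
    using ex_stationary by blast
  have "\<exists>!p. L *v p = 0 \<and> (\<Sum>i\<in>UNIV. p $ i) = 1"
    using p stationary_unique[OF p] unfolding coord_sum_def[symmetric]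
    by (intro ex1I[of _ p]) (metis scaleR_one)+
  from theI'[OF this]
  show "L *v stationary_density L = 0" "coord_sum (stationary_density L) = 1"
    by (simp_all add: stationary_density_def coord_sum_def)
qed

text \<open>The matrix with all columns p acts as x \<mapsto>
  \<open>coord_sum x *\<^sub>R p\<close>; its range is the line ker L and its kernel the hyperplane
  ran L. These properties determine the projector.\<close>

lemma zero_projector_entry: "zero_projector L $ i $ j = stationary_density L $ i"
proof -
  define p where "p = stationary_density L"
  have p: "L *v p = 0" "coord_sum p = 1"
    using stationary_density by (simp_all add: p_def)
  define P :: "real^'n^'n" where "P = (\<chi> i j. p $ i)"
  have Pv: "P *v x = coord_sum x *\<^sub>R p" for x
    by (simp add: P_def vec_eq_iff matrix_vector_mult_def coord_sum_def flip: sum_distrib_left)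
  have "zero_projector L = P"
    unfolding zero_projector_def
  proof (rule the_equality, intro conjI)
    show "P ** P = P"
      unfolding matrix_eq using p(2)
      by (simp add: Pv coord_sum_simps flip: matrix_vector_mul_assoc)
    show "range ((*v) P) = {x. L *v x = 0}"
      using p stationary_unique[OF p]
      by (auto simp: Pv image_iff matrix_vector_mult_scaleR)
    have "p \<noteq> 0"
      using p(2) by (auto simp: coord_sum_def)
    then show "{x. P *v x = 0} = range ((*v) L)"
      by (simp add: Pv range_L)
  next
    fix Q :: "real^'n^'n"
    assume Q: "Q ** Q = Q \<and> range ((*v) Q) = {x. L *v x = 0} \<and> {x. Q *v x = 0} = range ((*v) L)"
    have "Q *v x = P *v x" for x
    proof -
      have "L *v (Q *v x) = 0"
        using Q by blast
      then have Qx: "Q *v x = coord_sum (Q *v x) *\<^sub>R p"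
        by (rule stationary_unique[OF p])
      \<comment> \<open>Idempotence puts x - Qx into ker Q = ran L, so Q preserves the coordinate
        sum; this fixes the multiple of p that Qx is.\<close>
      have "Q *v (x - Q *v x) = 0"
        using Q by (simp add: matrix_vector_mult_diff_distrib matrix_vector_mul_assoc)
      then have "coord_sum (x - Q *v x) = 0"
        using Q range_L by blast
      then have "coord_sum (Q *v x) = coord_sum x"
        by (simp add: coord_sum_simps)
      then show ?thesis
        using Qx by (simp add: Pv)
    qed
    then show "Q = P"
      by (simp add: matrix_eq)
  qed
  then show ?thesis
    by (simp add: P_def p_def)
qed

text \<open>Split the j-th basis vector as p + x with x of zero sum. The resolvent fixes p because
  (I - sL)p = p, and its value at x decays like 1/s.\<close>

lemma resolvent_limit:
  assumes inv: "\<And>s. 0 < s \<Longrightarrow> invertible (mat 1 - s *\<^sub>R L)"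
  shows "((\<lambda>s. resolvent L s $ i $ j) \<longlongrightarrow> stationary_density L $ i) at_top"
proof -
  define p where "p = stationary_density L"
  have p: "L *v p = 0" "coord_sum p = 1"
    using stationary_density by (simp_all add: p_def)
  define x where "x = axis j 1 - p"
  let ?H = "{x::real^'n. coord_sum x = 0}"
  have H: "subspace ?H"
    by (rule linear_subspace_kernel[OF linear_coord_sum])
  have x: "coord_sum x = 0"
    using p(2) by (simp add: x_def coord_sum_simps) (simp add: coord_sum_def axis_def)
  have "\<exists>c>0. \<forall>x\<in>?H. norm (L *v x) \<ge> c * norm x"
    using kernel_zero_sum
    by (intro injective_imp_isometric closed_subspace H) (auto simp: linear_conv_bounded_linear[symmetric])
  then obtain c where c: "c > 0" "\<And>x. coord_sum x = 0 \<Longrightarrow> norm (L *v x) \<ge> c * norm x"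
    by auto
  \<comment> \<open>The solution y of y - sLy = x again has zero sum, so sc|y| \<le> |sLy| = |y - x|
    \<le> |y| + |x|. The condition on s makes sc - 1 positive.\<close>
  have bound: "norm (resolvent L s *v x) \<le> norm x / (s * c - 1)" if s: "s > 1 / c" for s
  proof -
    have s0: "s > 0" "s * c - 1 > 0"
      using s c(1) by (auto simp: field_simps intro: less_trans[of 0 "1 / c"])
    define y where "y = resolvent L s *v x"
    have "(mat 1 - s *\<^sub>R L) *v y = x"
      using matrix_inv_mult(2)[OF inv[OF s0(1)]]
      by (simp add: y_def resolvent_def matrix_vector_mul_assoc)
    then have y: "y - s *\<^sub>R (L *v y) = x"
      by (simp add: matrix_vector_mult_diff_rdistrib scaleR_matrix_vector_assoc)
    have "coord_sum y = 0"
      using arg_cong[OF y, of coord_sum] x coord_sum_L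
      by (simp add: coord_sum_simps)
    then have "s * (c * norm y) \<le> s * norm (L *v y)"
      using c(2) s0(1) by simp
    also have "\<dots> = norm (y - x)"
      using s0(1) y by (metis abs_of_pos add_diff_cancel_left' diff_add_cancel norm_scaleR)
    also have "\<dots> \<le> norm y + norm x"
      by (rule norm_triangle_ineq4)
    finally have "(s * c - 1) * norm y \<le> norm x"
      by (simp add: algebra_simps)
    then show ?thesis
      using s0(2) by (simp add: y_def pos_le_divide_eq mult.commute)
  qed
  have "((\<lambda>s. norm x / (s * c - 1)) \<longlongrightarrow> 0) at_top"
    using c(1) by real_asymp
  moreover have "eventually (\<lambda>s. norm ((resolvent L s *v x) $ i) \<le> norm x / (s * c - 1)) at_top"
    using eventually_gt_at_top[of "1 / c"]
    by eventually_elim (use bound component_le_norm_cart in \<open>auto intro: order_trans\<close>)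
  ultimately have "((\<lambda>s. (resolvent L s *v x) $ i) \<longlongrightarrow> 0) at_top"
    by (rule Lim_null_comparison[rotated])
  then have limit: "((\<lambda>s. p $ i + (resolvent L s *v x) $ i) \<longlongrightarrow> p $ i + 0) at_top"
    by (intro tendsto_intros)
  have entry: "p $ i + (resolvent L s *v x) $ i = resolvent L s $ i $ j" if s: "s > 0" for s
  proof -
    have "(mat 1 - s *\<^sub>R L) *v p = p"
      using p(1) by (simp add: matrix_vector_mult_diff_rdistrib flip: scaleR_matrix_vector_assoc)
    then have "resolvent L s *v p = (resolvent L s ** (mat 1 - s *\<^sub>R L)) *v p"
      by (simp flip: matrix_vector_mul_assoc)
    also have "\<dots> = p"
      unfolding resolvent_def matrix_inv_mult(1)[OF inv[OF s]] by simp
    finally have "p + resolvent L s *v x = resolvent L s *v axis j 1"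
      by (simp add: x_def matrix_vector_mult_diff_distrib)
    from arg_cong[OF this, of "\<lambda>x. x $ i"] show ?thesis
      by (simp add: matrix_vector_mult_basis column_def)
  qed
  have "eventually (\<lambda>s. p $ i + (resolvent L s *v x) $ i = resolvent L s $ i $ j) at_top"
    using eventually_gt_at_top[of 0] by eventually_elim (rule entry)
  with limit show ?thesis
    unfolding p_def add_0_right by (rule Lim_transform_eventually)
qed

end

section \<open>Small shifts\<close>

text \<open>Column j of the resolvent is the y with y = e_j + sAy. One further substitution gives
  y_i = s(A_ij + s(AAy)_i) for i \<noteq> j, and for small s the negative entry A_ij dominates the
  bracket.\<close>

lemma resolvent_entry_negative:
  fixes A :: "real^'n^'n"
  assumes inv: "\<And>s. 0 < s \<Longrightarrow> invertible (mat 1 - s *\<^sub>R A)"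
    and "i \<noteq> j" "A $ i $ j < 0"
  shows "\<exists>\<sigma>>0. \<forall>s\<in>{0<..<\<sigma>}. resolvent A s $ i $ j < 0"
proof -
  obtain B where B: "B > 0" "\<And>x. norm (A *v x) \<le> B * norm x"
    using linear_bounded_pos[of "(*v) A"] by auto
  \<comment> \<open>The first bound yields |y| \<le> 1 + |y|/2, hence |y| \<le> 2 and |AAy| \<le>
    \<open>2 * B\<^sup>2\<close>; the second keeps s times this below -A_ij.\<close>
  define \<sigma> where "\<sigma> = min (1 / (2 * B)) (- (A $ i $ j) / (2 * B\<^sup>2))"
  have "resolvent A s $ i $ j < 0" if s: "0 < s" "s < \<sigma>" for s
  proof -
    define y where "y = resolvent A s *v axis j 1"
    have "(mat 1 - s *\<^sub>R A) *v y = axis j 1"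
      using matrix_inv_mult(2)[OF inv[OF s(1)]]
      by (simp add: y_def resolvent_def matrix_vector_mul_assoc)
    then have y: "y = axis j 1 + s *\<^sub>R (A *v y)"
      by (simp add: matrix_vector_mult_diff_rdistrib scaleR_matrix_vector_assoc algebra_simps)
    have "s * B < 1 / 2" "s * (2 * B\<^sup>2) < - (A $ i $ j)"
      using s(2) B(1) by (simp_all add: \<sigma>_def field_simps)
    note small = this
    have "norm y \<le> 1 + s * norm (A *v y)"
      using s(1) norm_triangle_ineq[of "axis j 1" "s *\<^sub>R (A *v y)"] y by (simp add: norm_axis_1)
    also have "s * norm (A *v y) \<le> s * (B * norm y)"
      using s(1) B(2) by simp
    also have "\<dots> \<le> 1 / 2 * norm y"
      using mult_right_mono[of "s * B" "1 / 2" "norm y"] small(1) by (simp add: mult.assoc)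
    finally have "norm y \<le> 2" by simp
    have "norm (A *v (A *v y)) \<le> B * (B * norm y)"
      using B(1) by (intro order_trans[OF B(2)] mult_left_mono B(2)) auto
    also have "\<dots> \<le> B * (B * 2)"
      using B(1) \<open>norm y \<le> 2\<close> by simp
    finally have "(A *v (A *v y)) $ i \<le> 2 * B\<^sup>2"
      using component_le_norm_cart[of "A *v (A *v y)" i] by (simp add: power2_eq_square)
    then have "s * (A *v (A *v y)) $ i < - (A $ i $ j)"
      using small(2) s(1) mult_left_mono[of "(A *v (A *v y)) $ i" "2 * B\<^sup>2" s] by linarith
    moreover have "(A *v y) = A *v axis j 1 + s *\<^sub>R (A *v (A *v y))"
      by (subst y) (simp add: matrix_vector_right_distrib matrix_vector_mult_scaleR)
    then have "(A *v y) $ i = (A *v axis j 1) $ i + s * (A *v (A *v y)) $ i"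
      by (metis real_scaleR_def vector_add_component vector_scaleR_component)
    then have "(A *v y) $ i = A $ i $ j + s * (A *v (A *v y)) $ i"
      by (simp add: matrix_vector_mult_basis column_def)
    ultimately have "s * (A *v y) $ i < 0"
      using s(1) by (simp add: mult_pos_neg)
    moreover have "resolvent A s $ i $ j = y $ i"
      by (simp add: y_def matrix_vector_mult_basis column_def)
    moreover have "y $ i = s * (A *v y) $ i"
      using arg_cong[OF y, of "\<lambda>x. x $ i"] \<open>i \<noteq> j\<close> by (simp add: axis_def)
    ultimately show ?thesis by simp
  qed
  moreover have "0 < \<sigma>"
    using B(1) assms(3) by (simp add: \<sigma>_def divide_neg_pos)
  ultimately show ?thesis by auto
qed

section \<open>Windows, and assembly of the three statements\<close>

lemma nonneg_window_subset:
  assumes "lower_threshold A \<gamma>m" "upper_threshold A \<gamma>p"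
  shows "nonneg_window A \<subseteq> {\<gamma>m..\<gamma>p}"
proof
  fix \<gamma> assume \<gamma>: "\<gamma> \<in> nonneg_window A"
  then have nonneg: "\<not> cayley (\<gamma> *\<^sub>R A) $ i $ j < 0" for i j
    by (auto simp: nonneg_window_def mat_nonneg_def not_less)
  have "\<gamma> \<notin> {0<..<\<gamma>m}"
    using assms(1) nonneg unfolding lower_threshold_def by blast
  then have "\<not> \<gamma> < \<gamma>m"
    using \<gamma> by (simp add: nonneg_window_def)
  moreover have "\<not> \<gamma>p < \<gamma>"
    using assms(2) nonneg by (auto simp: upper_threshold_def)
  ultimately show "\<gamma> \<in> {\<gamma>m..\<gamma>p}" by simp
qed

theorem theorem3:
  fixes L :: "real^'n^'n"
  assumes "mat_irreducible L"
    and "zero_column_sums L"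
    and "spectral_abscissa L = 0"
    and "simple_eigenvalue L 0"
    and "eventually_exp_positive L"
  shows
    "(\<forall>\<gamma>>0. invertible (mat 1 - (\<gamma> / 2) *\<^sub>R L) \<and>
        cayley (\<gamma> *\<^sub>R L) = resolvent L (\<gamma> / 2) ** (mat 1 + (\<gamma> / 2) *\<^sub>R L) \<and>
        cayley (\<gamma> *\<^sub>R L) = - mat 1 + 2 *\<^sub>R resolvent L (\<gamma> / 2))
     \<and>
     (\<forall>i j. ((\<lambda>\<gamma>. cayley (\<gamma> *\<^sub>R L) $ i $ j)
        \<longlongrightarrow> (- mat 1 + 2 *\<^sub>R zero_projector L) $ i $ j) at_top)
     \<and>
     ((\<exists>i. stationary_density L $ i < 1 / 2) \<longrightarrow> (\<exists>\<gamma>p. upper_threshold L \<gamma>p))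
     \<and>
     ((\<exists>i j. i \<noteq> j \<and> L $ i $ j < 0) \<longrightarrow> (\<exists>\<gamma>m. lower_threshold L \<gamma>m))
     \<and>
     (\<forall>\<gamma>m \<gamma>p. lower_threshold L \<gamma>m \<and> upper_threshold L \<gamma>p \<longrightarrow>
        nonneg_window L \<subseteq> {\<gamma>m..\<gamma>p})
     \<and>
     (resolvent_window L \<inter> {\<gamma>. \<forall>i. 1 / 2 \<le> resolvent L (\<gamma> / 2) $ i $ i} \<noteq> {} \<longrightarrow>
        nonneg_window L \<noteq> {} \<and>
        (\<forall>\<gamma>m \<gamma>p. lower_threshold L \<gamma>m \<and> upper_threshold L \<gamma>p \<longrightarrow> {\<gamma>m..\<gamma>p} \<noteq> {}))"
proof -
  have "0 \<in> eigenvalues L"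
    using assms(4) by (simp add: simple_eigenvalue_def)
  then have inv: "invertible (mat 1 - s *\<^sub>R L)" if "0 < s" for s
    using assms(3) that by (intro invertible_resolvent) auto
  interpret exp_positive_generator L
    by unfold_locales (fact assms)+
  have cayley1: "cayley (\<gamma> *\<^sub>R L) = resolvent L (\<gamma> / 2) ** (mat 1 + (\<gamma> / 2) *\<^sub>R L)"
    and cayley2: "cayley (\<gamma> *\<^sub>R L) = - mat 1 + 2 *\<^sub>R resolvent L (\<gamma> / 2)" if "0 < \<gamma>" for \<gamma>
    using cayley_eq_resolvent[OF inv[of "\<gamma> / 2"]] that by simp_all
  have limit: "((\<lambda>\<gamma>. cayley (\<gamma> *\<^sub>R L) $ i $ j)
      \<longlongrightarrow> (- mat 1 + 2 *\<^sub>R zero_projector L) $ i $ j) at_top" for i j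
  proof -
    have "filterlim (\<lambda>\<gamma>::real. \<gamma> / 2) at_top at_top" by real_asymp
    with resolvent_limit[OF inv]
    have "((\<lambda>\<gamma>. resolvent L (\<gamma> / 2) $ i $ j) \<longlongrightarrow> zero_projector L $ i $ j) at_top"
      unfolding zero_projector_entry by (rule filterlim_compose)
    then have "((\<lambda>\<gamma>. - (mat 1 :: real^'n^'n) $ i $ j + 2 * resolvent L (\<gamma> / 2) $ i $ j)
        \<longlongrightarrow> - (mat 1 :: real^'n^'n) $ i $ j + 2 * zero_projector L $ i $ j) at_top"
      by (intro tendsto_add tendsto_mult tendsto_const)
    then have "((\<lambda>\<gamma>. - (mat 1 :: real^'n^'n) $ i $ j + 2 * resolvent L (\<gamma> / 2) $ i $ j)
        \<longlongrightarrow> (- mat 1 + 2 *\<^sub>R zero_projector L) $ i $ j) at_top"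
      by simp
    then show ?thesis
      by (rule Lim_transform_eventually)
        (use eventually_gt_at_top[of 0] in \<open>eventually_elim, simp add: cayley2\<close>)
  qed
  have upper: "\<exists>\<gamma>p. upper_threshold L \<gamma>p" if "stationary_density L $ i < 1 / 2" for i
  proof -
    \<comment> \<open>This limit is 2p_i - 1, so the diagonal entry is eventually negative
      too.\<close>
    have "(- mat 1 + 2 *\<^sub>R zero_projector L) $ i $ i < 0"
      using that by (simp add: zero_projector_entry mat_def)
    with limit[of i i] have "eventually (\<lambda>\<gamma>. cayley (\<gamma> *\<^sub>R L) $ i $ i < 0) at_top"
      by (rule order_tendstoD)
    then obtain g where "\<And>\<gamma>. \<gamma> > g \<Longrightarrow> cayley (\<gamma> *\<^sub>R L) $ i $ i < 0"
      by (auto simp: eventually_at_top_dense)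
    \<comment> \<open>The maximum with 1 ensures that the threshold is positive.\<close>
    then have "upper_threshold L (max g 1)"
      by (auto simp: upper_threshold_def)
    then show ?thesis by blast
  qed
  have lower: "\<exists>\<gamma>m. lower_threshold L \<gamma>m" if "i \<noteq> j" "L $ i $ j < 0" for i j
  proof -
    obtain \<sigma> where \<sigma>: "\<sigma> > 0" "\<And>s. 0 < s \<Longrightarrow> s < \<sigma> \<Longrightarrow> resolvent L s $ i $ j < 0"
      using resolvent_entry_negative[OF inv \<open>i \<noteq> j\<close> \<open>L $ i $ j < 0\<close>] by auto
    \<comment> \<open>Off the diagonal the Cayley entry is twice the resolvent entry at shift
      \<gamma>/2, so the range of shifts doubles.\<close>
    have "cayley (\<gamma> *\<^sub>R L) $ i $ j < 0" if "0 < \<gamma>" "\<gamma> < 2 * \<sigma>" for \<gamma>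
      using \<sigma>(2)[of "\<gamma> / 2"] that \<open>i \<noteq> j\<close> by (simp add: cayley2 mat_def)
    then have "lower_threshold L (2 * \<sigma>)"
      using \<sigma>(1) unfolding lower_threshold_def
      by (metis greaterThanLessThan_iff mult_pos_pos zero_less_numeral)
    then show ?thesis by blast
  qed
  have window: "nonneg_window L \<noteq> {}"
    if meet: "resolvent_window L \<inter> {\<gamma>. \<forall>i. 1 / 2 \<le> resolvent L (\<gamma> / 2) $ i $ i} \<noteq> {}"
  proof -
    obtain \<gamma> where "\<gamma> \<in> resolvent_window L" and diag: "\<forall>i. 1 / 2 \<le> resolvent L (\<gamma> / 2) $ i $ i"
      using meet by blast
    then have \<gamma>: "0 < \<gamma>" "\<And>i j. 0 < resolvent L (\<gamma> / 2) $ i $ j"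
      by (simp_all add: resolvent_window_def mat_positive_def)
    \<comment> \<open>Off the diagonal, positivity of the resolvent suffices; on it, 2R_ii - 1 \<ge>
      0 is the diagonal condition.\<close>
    have "0 \<le> cayley (\<gamma> *\<^sub>R L) $ i $ j" for i j
      using \<gamma>(2)[of i j] spec[OF diag, of i] \<gamma>(1)
      by (cases "i = j") (simp_all add: cayley2 mat_def)
    then show ?thesis
      using \<gamma>(1) by (auto simp: nonneg_window_def mat_nonneg_def)
  qed
  \<comment> \<open>Any parameter with a nonnegative Cayley matrix lies between the two
    thresholds.\<close>
  have "{\<gamma>m..\<gamma>p} \<noteq> {}"
    if "nonneg_window L \<noteq> {}" "lower_threshold L \<gamma>m" "upper_threshold L \<gamma>p" for \<gamma>m \<gamma>p
    using nonneg_window_subset[OF that(2,3)] that(1) by blast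
  with window have nonempty: "nonneg_window L \<noteq> {} \<and>
      (\<forall>\<gamma>m \<gamma>p. lower_threshold L \<gamma>m \<and> upper_threshold L \<gamma>p \<longrightarrow> {\<gamma>m..\<gamma>p} \<noteq> {})"
    if "resolvent_window L \<inter> {\<gamma>. \<forall>i. 1 / 2 \<le> resolvent L (\<gamma> / 2) $ i $ i} \<noteq> {}"
    using that by metis
  show ?thesis
  proof (intro conjI)
    show "\<forall>\<gamma>>0. invertible (mat 1 - (\<gamma> / 2) *\<^sub>R L) \<and>
        cayley (\<gamma> *\<^sub>R L) = resolvent L (\<gamma> / 2) ** (mat 1 + (\<gamma> / 2) *\<^sub>R L) \<and>
        cayley (\<gamma> *\<^sub>R L) = - mat 1 + 2 *\<^sub>R resolvent L (\<gamma> / 2)"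
      using inv cayley1 cayley2 half_gt_zero by blast
  next
    show "\<forall>i j. ((\<lambda>\<gamma>. cayley (\<gamma> *\<^sub>R L) $ i $ j)
        \<longlongrightarrow> (- mat 1 + 2 *\<^sub>R zero_projector L) $ i $ j) at_top"
      by (intro allI limit)
  next
    show "(\<exists>i. stationary_density L $ i < 1 / 2) \<longrightarrow> (\<exists>\<gamma>p. upper_threshold L \<gamma>p)"
      using upper by blast
  next
    show "(\<exists>i j. i \<noteq> j \<and> L $ i $ j < 0) \<longrightarrow> (\<exists>\<gamma>m. lower_threshold L \<gamma>m)"
      using lower by blast
  next
    show "\<forall>\<gamma>m \<gamma>p. lower_threshold L \<gamma>m \<and> upper_threshold L \<gamma>p \<longrightarrow>
        nonneg_window L \<subseteq> {\<gamma>m..\<gamma>p}"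
      using nonneg_window_subset by blast
  qed (rule impI, rule nonempty)
qed

end
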